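(* For every positive even integer $n$, $$\left[A_{n,1/2}^{-1}\right] = \left[2\left(n-\tfrac{1}{2}\right)^{1/2}\right],$$ and for every positive odd integer $n$, $$\left[B_{n,1/2}^{-1}\right] = \left[-2\left(n-\tfrac{1}{2}\right)^{1/2}\right].$$
   Context: For a positive integer $n$ and real $0<s<1$, define $A_{n,s} = \sum_{j=0}^{\infty}\left(\frac{1}{(n+2j)^s}-\frac{1}{(n+2j+1)^s}\right)$ and $B_{n,s} = \sum_{j=0}^{\infty}\left(-\frac{1}{(n+2j)^s}+\frac{1}{(n+2j+1)^s}\right)$. Here $A_{n,s}^{-1}=1/A_{n,s}$, $B_{n,s}^{-1}=1/B_{n,s}$, and $[x]$ denotes the greatest integer less than or equal to $x$. *)

theory Defs
  imports "HOL-Analysis.Analysis"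
begin

text \<open>The parameters of interest are \<open>n > 0\<close> and \<open>0 < s < 1\<close>. There the bases below are
  positive, so \<open>powr\<close> is the ordinary real power, and the series converge
  (lemmas \<open>summable_A\<close> and \<open>summable_B\<close>), so \<open>suminf\<close> is the genuine sum.\<close>

definition A :: "nat \<Rightarrow> real \<Rightarrow> real" where
  "A n s = (\<Sum>j. 1 / real (n + 2 * j) powr s - 1 / real (n + 2 * j + 1) powr s)"

definition B :: "nat \<Rightarrow> real \<Rightarrow> real" where
  "B n s = (\<Sum>j. - (1 / real (n + 2 * j) powr s) + 1 / real (n + 2 * j + 1) powr s)"

lemma summable_A:
  assumes "n > 0" "0 < s"
  shows "summable (\<lambda>j. 1 / real (n + 2 * j) powr s - 1 / real (n + 2 * j + 1) powr s)"
proof -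
  define f where "f k = 1 / real k powr s" for k :: nat
  have mono: "f k' \<le> f k" if "0 < k" "k \<le> k'" for k k'
    unfolding f_def using that assms by (intro divide_left_mono powr_mono2 mult_pos_pos) auto
  have "filterlim (\<lambda>j. real (n + 2 * j)) at_top sequentially"
    by (rule filterlim_at_top_mono[OF filterlim_real_sequentially]) auto
  hence "(\<lambda>j. real (n + 2 * j) powr (- s)) \<longlonglongrightarrow> 0"
    using assms by (intro tendsto_neg_powr) auto
  hence "(\<lambda>j. f (n + 2 * j)) \<longlonglongrightarrow> 0"
    by (simp add: f_def powr_minus_divide)
  hence "summable (\<lambda>j. f (n + 2 * j) - f (n + 2 * Suc j))"
    by (rule telescope_summable')
  hence "summable (\<lambda>j. f (n + 2 * j) - f (n + 2 * j + 1))"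
    by (rule summable_comparison_test'[where N = 0]) (use assms mono in auto)
  thus ?thesis by (simp add: f_def)
qed

lemma summable_B:
  assumes "n > 0" "0 < s"
  shows "summable (\<lambda>j. - (1 / real (n + 2 * j) powr s) + 1 / real (n + 2 * j + 1) powr s)"
  using summable_minus[OF summable_A[OF assms]] by simp

end

theory Submission
  imports Defs
begin

text \<open>Write \<open>f x = 1 / sqrt x\<close>. Both \<open>A n (1/2) > f n / 2\<close> and \<open>A n (1/2) \<le> f (n - 1/2) / 2\<close>
  follow by comparing the series termwise with a telescoping one: the first uses that \<open>f\<close> is
  strictly convex, the second that \<open>(f (c - t) - f (c + t)) / t\<close> increases with \<open>t\<close>.
  Hence \<open>sqrt (4 * n - 2) \<le> 1 / A n (1/2) < sqrt (4 * n)\<close>. As squares are \<open>0\<close> or \<open>1\<close> modulo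
  \<open>4\<close>, no square lies in \<open>[4 * n - 2, 4 * n)\<close>, so no integer separates
  \<open>1 / A n (1/2)\<close> from \<open>sqrt (4 * n - 2)\<close>.\<close>

text \<open>Rationalised form: it turns comparisons between differences of \<open>1 / sqrt\<close>
  into comparisons of denominators.\<close>

lemma inverse_sqrt_diff:
  fixes x y :: real
  assumes "0 < x" "0 < y"
  shows "1 / sqrt x - 1 / sqrt y = (y - x) / (sqrt x * sqrt y * (sqrt x + sqrt y))"
proof -
  have "y - x = (sqrt y - sqrt x) * (sqrt x + sqrt y)"
    using assms by (simp add: algebra_simps)
  moreover have "sqrt x + sqrt y > 0"
    using assms by (simp add: add_pos_pos)
  ultimately show ?thesis
    using assms by (simp add: diff_frac_eq)
qed

lemma inverse_sqrt_strict_convex: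
  fixes x :: real
  assumes "0 < x"
  shows "1 / sqrt (x + 1) - 1 / sqrt (x + 2) < 1 / sqrt x - 1 / sqrt (x + 1)"
proof -
  have "sqrt x * sqrt (x + 1) * (sqrt x + sqrt (x + 1))
      < sqrt (x + 1) * sqrt (x + 2) * (sqrt (x + 1) + sqrt (x + 2))"
    using assms by (intro mult_strict_mono add_strict_mono) (auto simp: mult.commute)
  hence "1 / (sqrt (x + 1) * sqrt (x + 2) * (sqrt (x + 1) + sqrt (x + 2)))
      < 1 / (sqrt x * sqrt (x + 1) * (sqrt x + sqrt (x + 1)))"
    using assms by (intro divide_strict_left_mono mult_pos_pos add_pos_pos) auto
  thus ?thesis
    using assms by (simp add: inverse_sqrt_diff)
qed

text \<open>After rationalising, the quotient at \<open>t\<close> is \<open>2 / (P t * S t)\<close>,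
  and both factors decrease as \<open>t\<close> grows.\<close>

lemma inverse_sqrt_central_diff_mono:
  fixes c s t :: real
  assumes "0 < s" "s \<le> t" "t < c"
  shows "(1 / sqrt (c - s) - 1 / sqrt (c + s)) / s \<le> (1 / sqrt (c - t) - 1 / sqrt (c + t)) / t"
proof -
  define P where "P u = sqrt (c - u) * sqrt (c + u)" for u
  define S where "S u = sqrt (c - u) + sqrt (c + u)" for u
  have quot: "(1 / sqrt (c - u) - 1 / sqrt (c + u)) / u = 2 / (P u * S u)"
    if "0 < u" "u < c" for u
    using that by (simp add: inverse_sqrt_diff P_def S_def)
  have P: "P t \<le> P s"
    using assms unfolding P_def real_sqrt_mult[symmetric]
    by (intro real_sqrt_le_mono) (simp add: algebra_simps mult_mono)
  \<comment> \<open>Squaring reduces the monotonicity of \<open>S\<close> to that of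
    \<open>P\<close>.\<close>
  have S_sq: "(S u)\<^sup>2 = 2 * c + 2 * P u" if "0 < u" "u < c" for u
    using that by (simp add: S_def P_def power2_sum)
  have "(S t)\<^sup>2 \<le> (S s)\<^sup>2"
    using P assms by (simp add: S_sq)
  hence S: "S t \<le> S s"
    by (rule power2_le_imp_le) (use assms in \<open>simp add: S_def\<close>)
  have pos: "P u > 0" "S u > 0" if "0 < u" "u < c" for u
    using that by (auto simp: P_def S_def add_pos_pos)
  have "2 / (P s * S s) \<le> 2 / (P t * S t)"
    using assms P S pos[of s] pos[of t]
    by (intro divide_left_mono mult_mono mult_pos_pos) auto
  thus ?thesis
    using assms by (simp add: quot)
qed

lemma inverse_sqrt_telescope_sums:
  fixes c :: real
  shows "(\<lambda>j. 1 / sqrt (c + 2 * real j) - 1 / sqrt (c + 2 * real (Suc j))) sums (1 / sqrt c)"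
proof -
  have "filterlim (\<lambda>j. c + real j * 2) at_top sequentially"
    by (intro filterlim_tendsto_add_at_top[OF tendsto_const]
        filterlim_at_top_mult_tendsto_pos[OF tendsto_const] filterlim_real_sequentially) simp
  hence "filterlim (\<lambda>j. sqrt (c + 2 * real j)) at_top sequentially"
    by (intro filterlim_compose[OF sqrt_at_top]) (simp add: mult.commute)
  hence "(\<lambda>j. 1 / sqrt (c + 2 * real j)) \<longlonglongrightarrow> 0"
    by (rule real_tendsto_divide_at_top[OF tendsto_const])
  from telescope_sums'[OF this] show ?thesis
    by simp
qed

lemma A_half_sums:
  assumes "0 < n"
  shows "(\<lambda>j. 1 / sqrt (real n + 2 * real j) - 1 / sqrt (real n + 2 * real j + 1)) sums A n (1/2)"
  using summable_sums[OF summable_A[OF assms, of "1/2"]]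
  by (simp add: A_def powr_half_sqrt add_ac)

lemma A_half_gt:
  assumes "0 < n"
  shows "1 / (2 * sqrt (real n)) < A n (1/2)"
proof -
  let ?a = "\<lambda>j. 1 / sqrt (real n + 2 * real j) - 1 / sqrt (real n + 2 * real j + 1)"
  let ?b = "\<lambda>j. (1 / sqrt (real n + 2 * real j) - 1 / sqrt (real n + 2 * real (Suc j))) / 2"
  have b: "?b sums (1 / sqrt (real n) / 2)"
    by (intro sums_divide inverse_sqrt_telescope_sums)
  have a: "?a sums A n (1/2)"
    by (rule A_half_sums[OF assms])
  \<comment> \<open>For values \<open>x\<close>, \<open>y\<close>, \<open>z\<close> of a convex
    decreasing function at equally spaced points, the first drop exceeds half of the total
    drop.\<close>
  have half: "(x - z) / 2 < x - y" if "y - z < x - y" for x y z :: real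
    using that by simp
  have "?b j < ?a j" for j
    using inverse_sqrt_strict_convex[of "real n + 2 * real j"] assms
    by (intro half) (simp add: add_ac)
  hence "0 < ?a j - ?b j" for j
    by (simp only: diff_gt_0_iff_gt)
  \<comment> \<open>The inequality has to stay strict after summation: when \<open>n\<close> is a
    perfect square, \<open>sqrt (4 * n)\<close> is an integer that \<open>1 / A n (1/2)\<close> must
    not reach.\<close>
  hence "0 < (\<Sum>j. ?a j - ?b j)"
    by (intro suminf_pos sums_summable[OF sums_diff[OF a b]])
  also have "\<dots> = A n (1/2) - 1 / sqrt (real n) / 2"
    using sums_unique[OF sums_diff[OF a b]] by simp
  finally show ?thesis
    by (simp add: mult.commute)
qed

lemma A_half_le:
  assumes "0 < n"
  shows "A n (1/2) \<le> 1 / (2 * sqrt (real n - 1/2))"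
proof -
  let ?a = "\<lambda>j. 1 / sqrt (real n + 2 * real j) - 1 / sqrt (real n + 2 * real j + 1)"
  let ?c = "real n - 1/2"
  let ?b = "\<lambda>j. (1 / sqrt (?c + 2 * real j) - 1 / sqrt (?c + 2 * real (Suc j))) / 2"
  have b: "?b sums (1 / sqrt ?c / 2)"
    by (intro sums_divide inverse_sqrt_telescope_sums)
  \<comment> \<open>The centre \<open>n + 2 * j + 1/2\<close> is the midpoint of the two arguments
    in \<open>?a j\<close>. Radius \<open>1/2\<close> gives \<open>?a j\<close>; radius
    \<open>1\<close> gives intervals of length 2 that abut, starting at \<open>n - 1/2\<close>, so
    \<open>?b\<close> telescopes.\<close>
  have "?a j \<le> ?b j" for j
    using inverse_sqrt_central_diff_mono[of "1/2" 1 "real n + 2 * real j + 1/2"] assms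
    by (simp add: algebra_simps)
  hence "A n (1/2) \<le> 1 / sqrt ?c / 2"
    by (rule sums_le[OF _ A_half_sums[OF assms] b])
  thus ?thesis
    by (simp add: mult.commute)
qed

lemma inverse_A_half_bounds:
  assumes "0 < n"
  shows "sqrt (4 * real n - 2) \<le> 1 / A n (1/2)" "1 / A n (1/2) < sqrt (4 * real n)"
proof -
  have pos: "0 < A n (1/2)"
    using A_half_gt[OF assms] by (rule le_less_trans[rotated]) simp
  have two: "sqrt (4 * x) = 2 * sqrt x" for x :: real
    by (simp add: real_sqrt_mult)
  have "0 < sqrt (real n - 1/2)" "0 < sqrt (real n)"
    using assms by auto
  hence "2 * sqrt (real n - 1/2) \<le> 1 / A n (1/2)" "1 / A n (1/2) < 2 * sqrt (real n)"
    using A_half_le[OF assms] A_half_gt[OF assms] pos by (auto simp: field_simps)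
  thus "sqrt (4 * real n - 2) \<le> 1 / A n (1/2)" "1 / A n (1/2) < sqrt (4 * real n)"
    using two[of "real n - 1/2"] two[of "real n"] by (simp_all add: algebra_simps)
qed

text \<open>A square is \<open>4 * q\<close> or \<open>4 * q + 1\<close>, so below
  \<open>4 * m\<close> it is at most \<open>4 * m - 3\<close>.\<close>

lemma int_square_gap:
  fixes k m :: int
  assumes "k\<^sup>2 < 4 * m"
  shows "k\<^sup>2 < 4 * m - 2"
proof (cases "even k")
  case True
  then obtain l where "k = 2 * l" by blast
  hence "k\<^sup>2 = 4 * l\<^sup>2" by (simp add: power_mult_distrib)
  thus ?thesis using assms by presburger
next
  case False
  then obtain l where "k = 2 * l + 1" by (rule oddE)
  hence "k\<^sup>2 = 4 * (l\<^sup>2 + l) + 1" by (simp add: power2_eq_square algebra_simps)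
  thus ?thesis using assms by presburger
qed

lemma of_int_less_sqrt_gap:
  fixes k :: int
  assumes "real_of_int k < sqrt (4 * real n)" "0 < n"
  shows "real_of_int k < sqrt (4 * real n - 2)"
\<comment> \<open>Squaring preserves the order only for nonnegative \<open>k\<close>; otherwise the
  positive root already lies above \<open>k\<close>.\<close>
proof (cases "k \<le> 0")
  case True
  have "0 < sqrt (4 * real n - 2)"
    using assms(2) by simp
  thus ?thesis
    using True by (meson le_less_trans of_int_le_0_iff)
next
  case False
  hence "(real_of_int k)\<^sup>2 < (sqrt (4 * real n))\<^sup>2"
    using assms(1) by (intro power_strict_mono) auto
  hence "real_of_int (k\<^sup>2) < real_of_int (4 * int n)"
    by simp
  hence "k\<^sup>2 < 4 * int n - 2"
    by (intro int_square_gap) (simp only: of_int_less_iff)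
  hence "real_of_int (k\<^sup>2) < real_of_int (4 * int n - 2)"
    by (simp only: of_int_less_iff)
  thus ?thesis
    by (intro real_less_rsqrt) simp
qed

theorem theorem2p8:
  shows "(\<forall>n::nat. 0 < n \<and> even n \<longrightarrow>
            \<lfloor>1 / A n (1/2)\<rfloor> = \<lfloor>2 * (real n - 1/2) powr (1/2)\<rfloor>) \<and>
         (\<forall>n::nat. 0 < n \<and> odd n \<longrightarrow>
            \<lfloor>1 / B n (1/2)\<rfloor> = \<lfloor>- 2 * (real n - 1/2) powr (1/2)\<rfloor>)"
proof -
  have root: "2 * (real n - 1/2) powr (1/2) = sqrt (4 * real n - 2)" if "0 < n" for n
  proof -
    have "sqrt (4 * real n - 2) = sqrt (4 * (real n - 1/2))"
      by (simp add: algebra_simps)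
    thus ?thesis
      using that by (simp only: real_sqrt_mult) (simp add: powr_half_sqrt)
  qed
  have B: "B n (1/2) = - A n (1/2)" if "0 < n" for n
    using suminf_minus[OF summable_A[OF that, of "1/2"]] by (simp add: A_def B_def)
  have floor: "\<lfloor>1 / A n (1/2)\<rfloor> = \<lfloor>sqrt (4 * real n - 2)\<rfloor>" if "0 < n" for n
  proof (rule antisym)
    have "real_of_int \<lfloor>1 / A n (1/2)\<rfloor> < sqrt (4 * real n)"
      using inverse_A_half_bounds(2)[OF that] by linarith
    from of_int_less_sqrt_gap[OF this that] show "\<lfloor>1 / A n (1/2)\<rfloor> \<le> \<lfloor>sqrt (4 * real n - 2)\<rfloor>"
      by (simp add: le_floor_iff)
  qed (intro floor_mono inverse_A_half_bounds that)
  \<comment> \<open>Since \<open>B n (1/2)\<close> is \<open>- A n (1/2)\<close>, the floor of its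
    reciprocal is minus a ceiling.\<close>
  have ceiling: "\<lceil>1 / A n (1/2)\<rceil> = \<lceil>sqrt (4 * real n - 2)\<rceil>" if "0 < n" for n
  proof (rule antisym)
    let ?k = "\<lceil>sqrt (4 * real n - 2)\<rceil>"
    \<comment> \<open>Were \<open>?k\<close> below \<open>sqrt (4 * n)\<close>, the gap would put it
      below \<open>sqrt (4 * n - 2)\<close>, whose ceiling it is.\<close>
    have "sqrt (4 * real n) \<le> real_of_int ?k"
      using of_int_less_sqrt_gap[OF _ that, of ?k] le_of_int_ceiling[of "sqrt (4 * real n - 2)"]
      by linarith
    thus "\<lceil>1 / A n (1/2)\<rceil> \<le> ?k"
      using inverse_A_half_bounds(2)[OF that] by (simp add: ceiling_le_iff)
  qed (intro ceiling_mono inverse_A_half_bounds that)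
  have "\<lfloor>1 / B n (1/2)\<rfloor> = \<lfloor>- 2 * (real n - 1/2) powr (1/2)\<rfloor>" if "0 < n" for n
    using ceiling[OF that] root[OF that] by (simp add: B[OF that] ceiling_def)
  thus ?thesis
    using floor root by simp
qed

end
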